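(* Let $m,n\ge 0$ be integers and let $\sigma\in\mathfrak{S}_m$. Then $$\sum_{\pi\in \mathfrak{I}_{n+m}(\sigma)} q^{\operatorname{maj}(\pi^{> m})} = \sum_{\substack{j\in J(\sigma)\\ k=n-m+j}} q^{\operatorname{maj}(\sigma^{>j})} \genfrac{[}{]}{0pt}{}{n}{k}_q\, t_k(q).$$
   Context: $\mathfrak{S}_N$ is the set of permutations $\pi=\pi_1\cdots\pi_N$ of $[N]=\{1,\dots,N\}$ in one-line notation, and $\mathfrak{I}_N$ is the set of involutions in $\mathfrak{S}_N$ (elements with $\pi=\pi^{-1}$, the identity included). For $\pi\in\mathfrak{S}_N$ and $0\le k\le N$: $\pi_{\le k}\in\mathfrak{S}_k$ is the permutation order-isomorphic to (i.e. the standardization of) the subword of $\pi$ consisting of the values $i\le k$; $\pi^{\le k}\in\mathfrak{S}_k$ is the one order-isomorphic to $\pi_1\cdots\pi_k$; $\pi^{>k}\in\mathfrak{S}_{N-k}$ is the one order-isomorphic to $\pi_{k+1}\cdots\pi_N$. For $\sigma\in\mathfrak{S}_m$, $\mathfrak{I}_N(\sigma)=\{\pi\in\mathfrak{I}_N:\pi_{\le m}=\sigma\}$. The $j$-set of $\sigma\in\mathfrak{S}_m$ is $J(\sigma)=\{0\le j\le m:\sigma^{\le j}\text{ is an involution}\}=\{j:\sigma^{\le j}=(\sigma^{-1})_{\le j}\}$ (always $0\in J(\sigma)$). A descent of $\pi\in\mathfrak{S}_N$ is $i\in[N-1]$ with $\pi_i>\pi_{i+1}$; $\operatorname{maj}(\pi)$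 is the sum of the descents of $\pi$. $t_k(q)=\sum_{\pi\in\mathfrak{I}_k}q^{\operatorname{maj}(\pi)}$. $[n]_q!=\prod_{i=1}^n(1+q+\cdots+q^{i-1})$ and $\genfrac{[}{]}{0pt}{}{n}{k}_q=\frac{[n]_q!}{[k]_q!\,[n-k]_q!}$ for $0\le k\le n$. Terms with $k<0$ are zero. The identity is between polynomials in $q$. *)

theory Defs
  imports
    "HOL-Combinatorics.Multiset_Permutations"
    "HOL-Computational_Algebra.Polynomial"
begin

text \<open>
  A permutation $\pi$ of $[N]$ is represented by its one-line notation, the list
  $[\pi_1, \dots, \pi_N]$. Positions are 1-based on paper and 0-based in
  lists, so $\pi_i$ is \<^term>\<open>w ! (i - 1)\<close>.
\<close>

definition Sym :: "nat \<Rightarrow> nat list set" where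
  "Sym N = permutations_of_set {1..N}"

definition perm_of_word :: "nat list \<Rightarrow> nat \<Rightarrow> nat" where
  "perm_of_word w i = (if i \<in> {1..length w} then w ! (i - 1) else i)"

definition is_involution :: "nat list \<Rightarrow> bool" where
  "is_involution w \<longleftrightarrow> perm_of_word w = inv (perm_of_word w)"

definition Inv :: "nat \<Rightarrow> nat list set" where
  "Inv N = {w \<in> Sym N. is_involution w}"

text \<open>
  Each letter of a repetition-free word is replaced by its rank, counted from 1.
\<close>

definition standardize :: "nat list \<Rightarrow> nat list" where
  "standardize w = map (\<lambda>x. card {y \<in> set w. y \<le> x}) w"

text \<open>
  \<open>values_le k w\<close>, \<open>prefix_le k w\<close> and \<open>suffix_gt k w\<close> are
  $\pi_{\le k}$, $\pi^{\le k}$ and $\pi^{>k}$ respectively.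
\<close>

definition values_le :: "nat \<Rightarrow> nat list \<Rightarrow> nat list" where
  "values_le k w = standardize (filter (\<lambda>x. x \<le> k) w)"

definition prefix_le :: "nat \<Rightarrow> nat list \<Rightarrow> nat list" where
  "prefix_le k w = standardize (take k w)"

definition suffix_gt :: "nat \<Rightarrow> nat list \<Rightarrow> nat list" where
  "suffix_gt k w = standardize (drop k w)"

definition Inv_over :: "nat \<Rightarrow> nat \<Rightarrow> nat list \<Rightarrow> nat list set" where
  "Inv_over N m \<sigma> = {w \<in> Inv N. values_le m w = \<sigma>}"

definition J_set :: "nat list \<Rightarrow> nat set" where
  "J_set \<sigma> = {j. j \<le> length \<sigma> \<and> is_involution (prefix_le j \<sigma>)}"

definition descents :: "nat list \<Rightarrow> nat set" where
  "descents w = {i. 1 \<le> i \<and> i < length w \<and> w ! (i - 1) > w ! i}"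

definition maj :: "nat list \<Rightarrow> nat" where
  "maj w = \<Sum> (descents w)"

text \<open>Polynomials in $q$ are elements of \<^typ>\<open>int poly\<close>; \<^term>\<open>monom 1 a\<close> is $q^a$.\<close>

definition inv_maj_poly :: "nat \<Rightarrow> int poly" where
  "inv_maj_poly k = (\<Sum>w\<in>Inv k. monom 1 (maj w))"

definition q_fact :: "nat \<Rightarrow> int poly" where
  "q_fact n = (\<Prod>i = 1..n. \<Sum>j<i. monom 1 j)"

text \<open>
  The division is exact, see \<open>q_binomial_mult\<close> below. Only the values for
  \<^prop>\<open>k \<le> n\<close> are meaningful, because of the truncated \<^term>\<open>n - k\<close>.
\<close>

definition q_binomial :: "nat \<Rightarrow> nat \<Rightarrow> int poly" where
  "q_binomial n k = q_fact n div (q_fact k * q_fact (n - k))"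

lemma q_fact_nonzero: "q_fact n \<noteq> 0"
proof -
  have "(\<Sum>j<i. monom (1 :: int) j) \<noteq> 0" if "i \<ge> 1" for i
  proof -
    have "coeff (\<Sum>j<i. monom (1 :: int) j) 0 = 1"
      using that by (simp add: coeff_sum)
    then show ?thesis by (metis coeff_0 zero_neq_one)
  qed
  then show ?thesis by (auto simp: q_fact_def)
qed

lemma q_fact_Suc: "q_fact (Suc n) = q_fact n * (\<Sum>j<Suc n. monom 1 j)"
  unfolding q_fact_def by (simp add: prod.nat_ivl_Suc' mult.commute del: sum.lessThan_Suc)

lemma q_fact_mult_dvd: "q_fact a * q_fact b dvd q_fact (a + b)"
proof (induction "a + b" arbitrary: a b)
  case 0
  then show ?case by (simp add: q_fact_def)
next
  case (Suc s)
  let ?I = "\<lambda>i. \<Sum>j<i. monom (1 :: int) j"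
  show ?case
  proof (cases "a = 0 \<or> b = 0")
    case True
    then show ?thesis by (auto simp: q_fact_def)
  next
    case False
    then obtain a' b' where ab: "a = Suc a'" "b = Suc b'"
      by (metis not0_implies_Suc)
    have "?I (x + y) = ?I x + monom 1 x * ?I y" for x y
      by (induction y) (simp_all add: mult_monom distrib_left add.assoc)
    then have split: "?I (a + b) = ?I a + monom 1 a * ?I b" .
    have 1: "q_fact a' * q_fact b dvd q_fact s" and 2: "q_fact a * q_fact b' dvd q_fact s"
      using Suc.hyps(1)[of a' b] Suc.hyps(1)[of a b'] Suc.hyps(2) ab by simp_all
    have "q_fact a * q_fact b dvd q_fact s * ?I a"
      using mult_dvd_mono[OF 1 dvd_refl[of "?I a"]]
      unfolding ab q_fact_Suc by (simp only: mult_ac)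
    moreover have "q_fact a * q_fact b dvd q_fact s * ?I b"
      using mult_dvd_mono[OF 2 dvd_refl[of "?I b"]]
      unfolding ab q_fact_Suc by (simp only: mult_ac)
    ultimately have "q_fact a * q_fact b dvd q_fact s * ?I a + monom 1 a * (q_fact s * ?I b)"
      by (intro dvd_add) (assumption, rule dvd_mult)
    also have "\<dots> = q_fact s * ?I (a + b)"
      unfolding split by (simp only: distrib_left mult_ac)
    also have "\<dots> = q_fact (a + b)"
      using q_fact_Suc[of s] Suc.hyps(2) by simp
    finally show ?thesis .
  qed
qed

lemma q_binomial_mult:
  assumes "k \<le> n"
  shows "q_binomial n k * (q_fact k * q_fact (n - k)) = q_fact n"
  using q_fact_mult_dvd[of k "n - k"] assms by (simp add: q_binomial_def)

end

theory Submission
  imports Defs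
begin

text \<open>
  Let \<open>\<pi>\<close> be an involution of $[n+m]$ whose letters \<open>\<le> m\<close>, read from left to right, form
  \<open>\<sigma>\<close>, and picture \<open>\<pi>\<close> as a symmetric permutation matrix. Let \<open>j\<close> be the number of
  ones in the $m \times m$ corner, that is, the number of letters \<open>\<le> m\<close> among the first \<open>m\<close>
  positions (\<open>corner_size\<close>).

  These letters are the first \<open>j\<close> letters of \<open>\<sigma>\<close>. By symmetry the set $A$ of their values is
  also the set of their positions, so \<open>\<pi>\<close> restricts to an involution of $A$. Hence
  \<open>\<sigma>\<^sup>\<le>\<^sup>j\<close> is an involution and \<open>j \<in> J(\<sigma>)\<close>; and \<open>j\<close> and \<open>\<sigma>\<close> determine \<open>\<pi>\<close>
  on $A$. The other $m-j$ letters of \<open>\<sigma>\<close> stand, in the order in which \<open>\<sigma>\<close> has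
  them, at positions $> m$. Every remaining position $> m$ carries a letter $> m$, and by symmetry
  \<open>\<pi>\<close> restricts to an involution of this set of $k = n-m+j$ positions; its standardization
  \<open>\<tau>\<close> is arbitrary. So \<open>\<pi>\<^sup>>\<^sup>m\<close> is a shuffle of \<open>\<sigma>\<^sup>>\<^sup>j\<close> with a copy of \<open>\<tau>\<close>
  on larger letters. Conversely such a shuffle shows where the two kinds of letters sit and what
  they are, and thereby gives \<open>\<pi>\<close> at all positions $> m$; the values of \<open>\<pi>\<close> at the positions in
  $[m] \setminus A$ follow from symmetry. This is the bijection of lemma \<open>bij_betw_suffix_gt\<close>.

  It remains to sum $q^{\mathrm{maj}}$ over all shuffles of two words on disjoint alphabets, which
  Stanley's shuffle theorem evaluates to
  $q^{\mathrm{maj}(u)+\mathrm{maj}(v)}$ times a $q$-binomial coefficient. Only the case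
  in which all letters of $u$ are smaller than all letters of $v$ occurs; it is lemma
  \<open>sum_maj_shuffles\<close>, and its proof is an induction that appends one letter at the right end and uses both
  forms of the $q$-Pascal recurrence.
\<close>

section \<open>The q-Pascal recurrences\<close>

definition q_int :: "nat \<Rightarrow> int poly" where
  "q_int n = (\<Sum>j<n. monom 1 j)"

lemma q_int_add: "q_int (a + b) = q_int a + monom 1 a * q_int b"
  by (induction b) (simp_all add: q_int_def mult_monom distrib_left add.assoc)

lemma q_fact_Suc_q_int: "q_fact (Suc n) = q_fact n * q_int (Suc n)"
  unfolding q_int_def by (rule q_fact_Suc)

lemma q_binomial_add_mult:
  "q_binomial (a + b) a * (q_fact a * q_fact b) = q_fact (a + b)"
  using q_binomial_mult[of a "a + b"] by simp

lemma q_fact_0 [simp]: "q_fact 0 = 1"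
  by (simp add: q_fact_def)

lemma q_binomial_0 [simp]: "q_binomial n 0 = 1"
  using q_fact_nonzero[of n] by (simp add: q_binomial_def)

lemma q_binomial_self [simp]: "q_binomial n n = 1"
  using q_fact_nonzero[of n] by (simp add: q_binomial_def)

lemma q_binomial_sym: "q_binomial (a + b) b = q_binomial (a + b) a"
  by (simp add: q_binomial_def mult.commute)

text \<open>
  Multiplied by \<open>[a + 1]! [b + 1]!\<close>, all three coefficients in the Pascal recurrence become
  \<open>[a + b + 1]!\<close> times a $q$-integer, and the recurrence reduces to
  $[a+b+2]_q = [a+1]_q + q^{a+1}[b+1]_q$. The next two lemmas clear the denominators on the right-hand side.
\<close>

lemma q_binomial_Suc_fact_left:
  "q_binomial (a + Suc b) a * (q_fact (Suc a) * q_fact (Suc b)) = q_fact (Suc (a + b)) * q_int (Suc a)"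
proof -
  have "q_binomial (a + Suc b) a * (q_fact (Suc a) * q_fact (Suc b))
      = q_binomial (a + Suc b) a * (q_fact a * q_fact (Suc b)) * q_int (Suc a)"
    by (simp only: q_fact_Suc_q_int[of a] mult_ac)
  also have "\<dots> = q_fact (Suc (a + b)) * q_int (Suc a)"
    unfolding q_binomial_add_mult by simp
  finally show ?thesis .
qed

lemma q_binomial_Suc_fact_right:
  "q_binomial (Suc a + b) (Suc a) * (q_fact (Suc a) * q_fact (Suc b)) = q_fact (Suc (a + b)) * q_int (Suc b)"
proof -
  have "q_binomial (Suc a + b) (Suc a) * (q_fact (Suc a) * q_fact (Suc b))
      = q_binomial (Suc a + b) (Suc a) * (q_fact (Suc a) * q_fact b) * q_int (Suc b)"
    by (simp only: q_fact_Suc_q_int[of b] mult_ac)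
  also have "\<dots> = q_fact (Suc (a + b)) * q_int (Suc b)"
    unfolding q_binomial_add_mult by simp
  finally show ?thesis .
qed

lemma q_binomial_pascal_left:
  "q_binomial (Suc a + Suc b) (Suc a) =
     q_binomial (a + Suc b) a + monom 1 (Suc a) * q_binomial (Suc a + b) (Suc a)"
proof -
  let ?c = "q_fact (Suc a) * q_fact (Suc b)"
  have "q_binomial (Suc a + Suc b) (Suc a) * ?c = q_fact (Suc (a + b)) * q_int (Suc a + Suc b)"
    using q_binomial_add_mult[of "Suc a" "Suc b"] q_fact_Suc_q_int[of "Suc (a + b)"] by simp
  also have "\<dots> = (q_binomial (a + Suc b) a + monom 1 (Suc a) * q_binomial (Suc a + b) (Suc a)) * ?c"
    unfolding q_int_add distrib_left distrib_right mult.assoc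
      q_binomial_Suc_fact_left q_binomial_Suc_fact_right by (simp only: mult_ac)
  finally show ?thesis using q_fact_nonzero by simp
qed

lemma q_binomial_pascal_right:
  "q_binomial (Suc a + Suc b) (Suc a) =
     monom 1 (Suc b) * q_binomial (a + Suc b) a + q_binomial (Suc a + b) (Suc a)"
  using q_binomial_pascal_left[of b a] q_binomial_sym[of "Suc a" "Suc b"]
    q_binomial_sym[of "Suc a" b] q_binomial_sym[of a "Suc b"]
  by (simp add: add.commute)

section \<open>The major index on shuffles\<close>

lemma maj_Nil [simp]: "maj [] = 0" and maj_single [simp]: "maj [x] = 0"
  by (simp_all add: maj_def descents_def)

text \<open>
  The final letter contributes through the last adjacent pair only. This is why the
  inductions below work at the right end of a word: there the descents that are already counted keep their
  positions.
\<close>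

lemma maj_snoc2: "maj (w @ [a, b]) = maj (w @ [a]) + (if b < a then Suc (length w) else 0)"
proof -
  have "descents (w @ [a, b]) = descents (w @ [a]) \<union> (if b < a then {Suc (length w)} else {})"
    by (auto simp: descents_def nth_append less_Suc_eq split: if_splits)
  moreover have "finite (descents (w @ [a]))" "Suc (length w) \<notin> descents (w @ [a])"
    by (auto simp: descents_def)
  ultimately show ?thesis by (auto simp: maj_def)
qed

lemma maj_map_strict_mono:
  assumes "strict_mono f" shows "maj (map f w) = maj w"
proof -
  have "descents (map f w) = descents w"
    using strict_mono_less[OF assms] by (auto simp: descents_def)
  then show ?thesis by (simp add: maj_def)
qed

text \<open>
  When a predicate separates the letters of the two words, a shuffle is recognized by its two
  subwords.
\<close>

lemma shuffles_eq_filter: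
  assumes "\<forall>x\<in>set xs. P x" "\<forall>y\<in>set ys. \<not> P y"
  shows "shuffles xs ys = {zs. filter P zs = xs \<and> filter (\<lambda>x. \<not> P x) zs = ys}"
proof -
  have "shuffles xs ys = partition P -` {(xs, ys)}"
    using assms by (intro inv_image_partition[symmetric]) auto
  then show ?thesis by (simp add: vimage_def o_def)
qed

lemma shuffles_snoc_snoc:
  assumes "set (xs @ [x]) \<inter> set (ys @ [y]) = {}"
  shows "shuffles (xs @ [x]) (ys @ [y]) =
    (\<lambda>zs. zs @ [x]) ` shuffles xs (ys @ [y]) \<union> (\<lambda>zs. zs @ [y]) ` shuffles (xs @ [x]) ys"
proof -
  let ?P = "\<lambda>z. z \<in> set (xs @ [x])"
  have P: "\<forall>z\<in>set (xs @ [x]). ?P z" "\<forall>z\<in>set xs. ?P z"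
    "\<forall>z\<in>set (ys @ [y]). \<not> ?P z" "\<forall>z\<in>set ys. \<not> ?P z"
    using assms by auto
  have "zs \<in> shuffles (xs @ [x]) (ys @ [y]) \<longleftrightarrow>
     zs \<in> (\<lambda>zs. zs @ [x]) ` shuffles xs (ys @ [y]) \<union> (\<lambda>zs. zs @ [y]) ` shuffles (xs @ [x]) ys" for zs
    unfolding shuffles_eq_filter[OF P(1,3)] shuffles_eq_filter[OF P(2,3)] shuffles_eq_filter[OF P(1,4)]
    by (cases zs rule: rev_cases) (use P in auto)
  then show ?thesis by blast
qed

lemma sum_shuffles_snoc_snoc:
  assumes "set (xs @ [x]) \<inter> set (ys @ [y]) = {}"
  shows "(\<Sum>zs\<in>shuffles (xs @ [x]) (ys @ [y]). f zs) =
    (\<Sum>zs\<in>shuffles xs (ys @ [y]). f (zs @ [x])) + (\<Sum>zs\<in>shuffles (xs @ [x]) ys. f (zs @ [y]))"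
  unfolding shuffles_snoc_snoc[OF assms]
  by (subst sum.union_disjoint) (use assms in \<open>auto simp: sum.reindex inj_on_def\<close>)

text \<open>
  The core of the shuffle theorem. The shuffles of $u$ and $v$ are followed by an extra letter that
  could extend $u$ (the small letter $x$) or $v$ (the large letter $y$). Removing the last
  letter of the shuffle turns either sum into one of each kind for shorter words, so that the two formulas
  need a common induction. The extra \<open>length v\<close> in the exponent for $x$ reflects that a small
  letter after a letter of $v$ always creates a descent.
\<close>

lemma maj_shuffles_snoc:
  assumes "\<forall>a\<in>set u. \<forall>b\<in>set v. a < b" "\<forall>b\<in>set v. x < b" "\<forall>a\<in>set u. a < y"
  shows "(\<Sum>z\<in>shuffles u v. monom (1::int) (maj (z @ [x]))) =
      monom 1 (maj (u @ [x]) + maj v + length v) * q_binomial (length u + length v) (length u) \<and>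
    (\<Sum>z\<in>shuffles u v. monom (1::int) (maj (z @ [y]))) =
      monom 1 (maj u + maj (v @ [y])) * q_binomial (length u + length v) (length u)"
  using assms
proof (induction "length u + length v" arbitrary: u v x y rule: less_induct)
  case less
  note ord = less.prems(1) and x = less.prems(2) and y = less.prems(3)
  consider "u = []" | "v = []" | u' x' v' y' where "u = u' @ [x']" "v = v' @ [y']"
    by (cases u rule: rev_cases; cases v rule: rev_cases) auto
  then show ?case
  proof cases
    case 1
    then show ?thesis using x by (cases v rule: rev_cases) (simp_all add: maj_snoc2)
  next
    case 2
    then show ?thesis using y by (cases u rule: rev_cases) (simp_all add: maj_snoc2)
  next
    case 3
    let ?a = "length u'" and ?b = "length v'"
    define L where "L = q_binomial (?a + Suc ?b) ?a"
    define R where "R = q_binomial (Suc ?a + ?b) (Suc ?a)"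
    have disj: "set (u' @ [x']) \<inter> set (v' @ [y']) = {}"
      using ord unfolding 3 by (meson disjoint_iff less_irrefl)
    have 1: "(\<Sum>z\<in>shuffles u' v. monom (1::int) (maj (z @ [x']))) =
        monom 1 (maj u + maj v + Suc ?b) * L"
    proof -
      have "length u' + length v < length u + length v" "\<forall>a\<in>set u'. \<forall>b\<in>set v. a < b"
        "\<forall>b\<in>set v. x' < b" "\<forall>a\<in>set u'. a < y'"
        using ord 3 by auto
      from less.hyps[OF this] show ?thesis by (simp add: L_def 3)
    qed
    have 2: "(\<Sum>z\<in>shuffles u v'. monom (1::int) (maj (z @ [y']))) = monom 1 (maj u + maj v) * R"
    proof -
      have "length u + length v' < length u + length v" "\<forall>a\<in>set u. \<forall>b\<in>set v'. a < b"
        "\<forall>b\<in>set v'. x' < b" "\<forall>a\<in>set u. a < y'"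
        using ord 3 by auto
      from less.hyps[OF this] show ?thesis by (simp add: R_def 3)
    qed
    have step: "(\<Sum>z\<in>shuffles u v. monom (1::int) (maj (z @ [t]))) =
        monom 1 (if t < x' then Suc (Suc (?a + ?b)) else 0) * (monom 1 (maj u + maj v + Suc ?b) * L) +
        monom 1 (if t < y' then Suc (Suc (?a + ?b)) else 0) * (monom 1 (maj u + maj v) * R)" for t
      unfolding 1[symmetric] 2[symmetric] unfolding 3 sum_shuffles_snoc_snoc[OF disj] sum_distrib_left
      by (intro arg_cong2[of _ _ _ _ "(+)"] sum.cong)
         (auto simp: maj_snoc2 mult_monom add.commute dest: length_shuffles)
    \<comment> \<open>A descent between the last letter of \<open>u\<close> and \<open>x\<close>, or the last letter of \<open>v\<close> and \<open>y\<close>,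
      decides which of the two recurrences matches the exponents.\<close>
    have PL: "q_binomial (length u + length v) (length u) = L + monom 1 (Suc ?a) * R"
      and PR: "q_binomial (length u + length v) (length u) = monom 1 (Suc ?b) * L + R"
      using q_binomial_pascal_left[of ?a ?b] q_binomial_pascal_right[of ?a ?b] 3
      by (simp_all add: L_def R_def)
    have xy: "x < y'" "x' < y" using x y 3 by auto
    have "(\<Sum>z\<in>shuffles u v. monom (1::int) (maj (z @ [x]))) =
       monom 1 (maj (u @ [x]) + maj v + length v) * q_binomial (length u + length v) (length u)"
    proof (cases "x < x'")
      case True
      show ?thesis unfolding step PR using True xy 3
        by (simp add: maj_snoc2 mult_monom distrib_left mult.assoc[symmetric] add_ac)
    next
      case False
      show ?thesis unfolding step PL using False xy 3
        by (simp add: maj_snoc2 mult_monom distrib_left mult.assoc[symmetric] add_ac)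
    qed
    moreover have "(\<Sum>z\<in>shuffles u v. monom (1::int) (maj (z @ [y]))) =
       monom 1 (maj u + maj (v @ [y])) * q_binomial (length u + length v) (length u)"
    proof (cases "y < y'")
      case True
      show ?thesis unfolding step PL using True xy 3
        by (simp add: maj_snoc2 mult_monom distrib_left mult.assoc[symmetric] add_ac)
    next
      case False
      show ?thesis unfolding step PR using False xy 3
        by (simp add: maj_snoc2 mult_monom distrib_left mult.assoc[symmetric] add_ac)
    qed
    ultimately show ?thesis by blast
  qed
qed

lemma maj_snoc_greater:
  assumes "\<forall>a\<in>set w. a \<le> y" shows "maj (w @ [y]) = maj w"
  using assms by (cases w rule: rev_cases) (simp_all add: maj_snoc2)

text \<open>
  The shuffle theorem for two words with all letters of the first below those of the second. A letter
  above everything may be appended without changing any major index, which reduces the claim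
  to the second formula of \<open>maj_shuffles_snoc\<close>.
\<close>

lemma sum_maj_shuffles:
  assumes "\<forall>a\<in>set u. \<forall>b\<in>set v. a < b"
  shows "(\<Sum>z\<in>shuffles u v. monom (1::int) (maj z)) =
    monom 1 (maj u + maj v) * q_binomial (length u + length v) (length u)"
proof -
  define y where "y = Suc (sum_list (u @ v))"
  have y: "a < y" if "a \<in> set u \<union> set v" for a
    using that member_le_sum_list[of a "u @ v"] by (simp add: y_def)
  have "(\<Sum>z\<in>shuffles u v. monom (1::int) (maj z)) = (\<Sum>z\<in>shuffles u v. monom 1 (maj (z @ [y])))"
  proof (intro sum.cong refl)
    fix z assume "z \<in> shuffles u v"
    then have "\<forall>a\<in>set z. a \<le> y"
      using y by (metis less_imp_le set_shuffles)
    then show "monom (1::int) (maj z) = monom 1 (maj (z @ [y]))"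
      by (simp add: maj_snoc_greater)
  qed
  also have "\<dots> = monom 1 (maj u + maj (v @ [y])) * q_binomial (length u + length v) (length u)"
  proof (cases "u = []")
    case True then show ?thesis by simp
  next
    case False
    \<comment> \<open>\<open>hd u\<close> serves as the letter below all of \<open>v\<close> in \<open>maj_shuffles_snoc\<close>.\<close>
    then have "\<forall>b\<in>set v. hd u < b" "\<forall>a\<in>set u. a < y"
      using assms y by auto
    from maj_shuffles_snoc[OF assms this] show ?thesis by simp
  qed
  also have "maj (v @ [y]) = maj v"
    using y by (intro maj_snoc_greater ballI less_imp_le) blast
  finally show ?thesis .
qed

section \<open>Standardization and involutions of finite sets\<close>

definition rank :: "nat set \<Rightarrow> nat \<Rightarrow> nat" where
  "rank X x = card {y \<in> X. y \<le> x}"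

lemma standardize_rank: "standardize w = map (rank (set w)) w"
  by (simp add: standardize_def rank_def)

lemma rank_less:
  assumes "finite X" "y \<in> X" "x < y" shows "rank X x < rank X y"
proof -
  have "{z \<in> X. z \<le> x} \<subseteq> {z \<in> X. z \<le> y}" "y \<in> {z \<in> X. z \<le> y} - {z \<in> X. z \<le> x}"
    using assms by auto
  then show ?thesis
    unfolding rank_def using assms(1) by (intro psubset_card_mono) auto
qed

lemma rank_mono: "finite X \<Longrightarrow> x \<le> y \<Longrightarrow> rank X x \<le> rank X y"
  unfolding rank_def by (intro card_mono) auto

lemma rank_le_iff:
  assumes "finite X" "x \<in> X" shows "rank X x \<le> rank X m \<longleftrightarrow> x \<le> m"
  using rank_less[OF assms, of m] rank_mono[OF assms(1), of x m] by force

lemma inj_on_rank: "finite X \<Longrightarrow> inj_on (rank X) X"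
  by (rule inj_onI) (metis less_not_refl linorder_less_linear rank_less)

lemma bij_betw_rank:
  assumes "finite X" shows "bij_betw (rank X) X {1..card X}"
proof -
  have "rank X x \<in> {1..card X}" if "x \<in> X" for x
  proof -
    have "{y \<in> X. y \<le> x} \<noteq> {}" using that by auto
    then show ?thesis
      using assms by (auto simp: rank_def card_gt_0_iff Suc_le_eq intro!: card_mono)
  qed
  then have "rank X ` X \<subseteq> {1..card X}" by blast
  moreover have "card (rank X ` X) = card {1..card X}"
    using inj_on_rank[OF assms] by (simp add: card_image)
  ultimately show ?thesis
    using inj_on_rank[OF assms] by (simp add: bij_betw_def card_subset_eq)
qed

lemma rank_atLeastAtMost: "x \<le> N \<Longrightarrow> rank {1..N} x = x"
proof -
  assume "x \<le> N"
  then have "{y \<in> {1..N}. y \<le> x} = {1..x}" by auto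
  then show ?thesis by (simp add: rank_def)
qed

lemma rank_nth_sorted_list_of_set:
  assumes "finite X" "i < card X" shows "rank X (sorted_list_of_set X ! i) = Suc i"
proof -
  let ?e = "sorted_list_of_set X"
  have len: "length ?e = card X" by simp
  have less: "?e ! a < ?e ! b \<longleftrightarrow> a < b" if "a < card X" "b < card X" for a b
  proof -
    have s: "sorted_wrt (<) ?e" by simp
    show ?thesis
      using sorted_wrt_nth_less[OF s, of a b] sorted_wrt_nth_less[OF s, of b a] that len
      by (metis linorder_neqE_nat less_asym)
  qed
  have "{y \<in> X. y \<le> ?e ! i} = (!) ?e ` {..i}"
  proof (intro equalityI subsetI)
    fix y assume "y \<in> {y \<in> X. y \<le> ?e ! i}"
    then have "y \<in> set ?e" "y \<le> ?e ! i" using assms by auto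
    then obtain a where "a < card X" "y = ?e ! a" by (metis in_set_conv_nth len)
    then show "y \<in> (!) ?e ` {..i}"
      using less[of i a] assms \<open>y \<le> ?e ! i\<close> by (auto simp: not_less[symmetric])
  next
    fix y assume "y \<in> (!) ?e ` {..i}"
    then obtain a where a: "a \<le> i" "y = ?e ! a" by auto
    then have "y \<in> set ?e" using assms len by (metis le_less_trans nth_mem)
    moreover have "y \<le> ?e ! i" using less[of i a] a assms by (auto simp: not_less[symmetric])
    ultimately show "y \<in> {y \<in> X. y \<le> ?e ! i}" using assms by simp
  qed
  moreover have "inj_on ((!) ?e) {..i}"
    using assms by (intro inj_on_nth) auto
  ultimately show ?thesis by (simp add: rank_def card_image)
qed

lemma Sym_iff: "w \<in> Sym N \<longleftrightarrow> set w = {1..N} \<and> distinct w"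
  by (auto simp: Sym_def permutations_of_set_def)

lemma length_Sym: "w \<in> Sym N \<Longrightarrow> length w = N"
  using distinct_card[of w] by (simp add: Sym_iff)

lemma standardize_Sym: "w \<in> Sym N \<Longrightarrow> standardize w = w"
  by (auto simp: standardize_rank Sym_iff rank_atLeastAtMost simp del: One_nat_def intro!: map_idI)

lemma standardize_in_Sym: "distinct w \<Longrightarrow> standardize w \<in> Sym (length w)"
  using bij_betw_rank[of "set w"]
  by (simp add: Sym_iff standardize_rank distinct_map bij_betw_def distinct_card)

lemma standardize_inject:
  assumes "set v = set w" "standardize v = standardize w" shows "v = w"
  using assms inj_on_rank[of "set w"] by (auto simp: standardize_rank inj_on_map_eq_map)

text \<open>
  Cutting a word at the value $m$ commutes with standardization if the standardized word is cut at
  the rank of $m$, which is the number of letters \<open>\<le> m\<close>. The upper part then appears shifted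
  by that number.
\<close>

lemma filter_le_standardize:
  "filter (\<lambda>x. x \<le> rank (set d) m) (standardize d) = standardize (filter (\<lambda>x. x \<le> m) d)"
proof -
  have "rank {y \<in> set d. y \<le> m} x = rank (set d) x" if "x \<le> m" for x
    unfolding rank_def using that by (intro arg_cong[of _ _ card]) auto
  then show ?thesis
    by (auto simp: standardize_rank filter_map rank_le_iff o_def cong: filter_cong intro!: map_cong)
qed

lemma filter_gt_standardize:
  "filter (\<lambda>x. \<not> x \<le> rank (set d) m) (standardize d) =
    map ((+) (rank (set d) m)) (standardize (filter (\<lambda>x. \<not> x \<le> m) d))"
proof -
  have "rank (set d) m + rank {y \<in> set d. \<not> y \<le> m} x = rank (set d) x" if "\<not> x \<le> m" for x
  proof -
    have "{y \<in> set d. y \<le> x} = {y \<in> set d. y \<le> m} \<union> {y \<in> {y \<in> set d. \<not> y \<le> m}. y \<le> x}"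
      using that by auto
    then show ?thesis by (simp only: rank_def) (subst card_Un_disjoint, auto)
  qed
  then show ?thesis
    by (auto simp: standardize_rank filter_map rank_le_iff o_def cong: filter_cong intro!: map_cong)
qed

abbreviation word :: "(nat \<Rightarrow> nat) \<Rightarrow> nat set \<Rightarrow> nat list" where
  "word f X \<equiv> map f (sorted_list_of_set X)"

lemma filter_word:
  assumes "finite X" shows "filter P (word f X) = word f {x \<in> X. P (f x)}"
proof -
  have "filter (P \<circ> f) (sorted_list_of_set X) = sorted_list_of_set {x \<in> X. P (f x)}"
    using assms by (intro sorted_distinct_set_unique) (auto simp: sorted_wrt_filter)
  then show ?thesis by (simp add: filter_map)
qed

lemma word_append: "word f {1..n + m} = word f {1..m} @ word f {m<..n + m}"
proof -
  have "sorted_list_of_set {1..n + m} = [1..<Suc (n + m)]"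
    "sorted_list_of_set {1..m} = [1..<Suc m]" "sorted_list_of_set {m<..n + m} = [Suc m..<Suc (n + m)]"
    by (simp_all flip: sorted_list_of_set_range atLeastLessThanSuc_atLeastAtMost
          atLeastSucAtMost_greaterThanAtMost del: upt_Suc)
  moreover have "[1..<Suc (n + m)] = [1..<Suc m] @ [Suc m..<Suc (n + m)]"
    using upt_add_eq_append[of 1 "Suc m" n] by (simp del: upt_Suc add: add.commute)
  ultimately show ?thesis by simp
qed

lemma take_word: "take m (word f {1..n + m}) = word f {1..m}"
  and drop_word: "drop m (word f {1..n + m}) = word f {m<..n + m}"
  by (simp_all add: word_append del: One_nat_def)

lemma standardize_word:
  "finite X \<Longrightarrow> standardize (word f X) = word (\<lambda>x. rank (f ` X) (f x)) X"
  by (simp add: standardize_rank)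

lemma distinct_word: "bij_betw f X Y \<Longrightarrow> distinct (word f X)"
  by (cases "finite X") (auto simp: distinct_map bij_betw_def)

text \<open>
  Sending the $i$-th smallest element of \<open>X\<close> to the $i$-th letter passes from one-line notation
  to functions on an arbitrary set of positions.
\<close>

lemma word_of_list:
  assumes "finite X" "distinct v" "length v = card X"
  obtains f where "word f X = v" "bij_betw f X (set v)"
proof
  let ?f = "\<lambda>x. v ! (rank X x - 1)"
  show w: "word ?f X = v"
    using assms by (intro nth_equalityI) (auto simp: rank_nth_sorted_list_of_set)
  have "?f ` X = set v"
    using arg_cong[OF w, of set] assms(1) by simp
  then show "bij_betw ?f X (set v)"
    using assms distinct_card[of v] by (auto simp: bij_betw_def intro: eq_card_imp_inj_on)
qed

definition involution_on :: "nat set \<Rightarrow> (nat \<Rightarrow> nat) \<Rightarrow> bool" where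
  "involution_on X f \<longleftrightarrow> (\<forall>x\<in>X. f x \<in> X \<and> f (f x) = x)"

lemma involution_on_bij_betw: "involution_on X f \<Longrightarrow> bij_betw f X X"
  unfolding involution_on_def by (intro bij_betw_byWitness[where f' = f]) auto

lemma is_involution_iff:
  assumes "w \<in> Sym N"
  shows "is_involution w \<longleftrightarrow> (\<forall>i\<in>{1..N}. perm_of_word w (perm_of_word w i) = i)"
proof -
  let ?p = "perm_of_word w"
  have len: "length w = N" and w: "set w = {1..N}" "distinct w"
    using assms by (auto simp: length_Sym Sym_iff)
  have "inj_on ?p {1..N}"
    using w(2) len by (auto simp: inj_on_def perm_of_word_def nth_eq_iff_index_eq)
  moreover have "?p ` {1..N} \<subseteq> {1..N}"
  proof (intro image_subsetI)
    fix i assume "i \<in> {1..N}"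
    then have "w ! (i - 1) \<in> set w" using len by (intro nth_mem) auto
    then show "?p i \<in> {1..N}" using w len \<open>i \<in> {1..N}\<close> by (simp add: perm_of_word_def)
  qed
  ultimately have "bij_betw ?p {1..N} {1..N}"
    by (simp add: bij_betw_def endo_inj_surj)
  then have p: "?p permutes {1..N}"
    by (rule bij_imp_permutes) (auto simp: perm_of_word_def len)
  show ?thesis
  proof
    assume "is_involution w"
    then show "\<forall>i\<in>{1..N}. ?p (?p i) = i"
      using permutes_inverses(1)[OF p] unfolding is_involution_def by metis
  next
    assume *: "\<forall>i\<in>{1..N}. ?p (?p i) = i"
    have "?p (?p i) = i" for i
      using * permutes_not_in[OF p, of i] by (cases "i \<in> {1..N}") simp_all
    then have "inv ?p = ?p" by (intro inv_equality) auto
    then show "is_involution w" by (simp add: is_involution_def)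
  qed
qed

text \<open>
  The increasing bijection between $X$ and $\{1,\dots,|X|\}$ conjugates $f$ to the
  permutation whose one-line notation is the standardization. Therefore an involution on a set of positions can
  be tested on the standardized subword.
\<close>

lemma standardize_word_Inv_iff:
  assumes "finite X" "bij_betw f X X"
  shows "standardize (word f X) \<in> Inv (card X) \<longleftrightarrow> involution_on X f"
proof -
  define w where "w = standardize (word f X)"
  have X: "set (word f X) = X" "f ` X = X" using assms by (auto simp: bij_betw_def)
  have len: "length w = card X" by (simp add: w_def standardize_rank)
  have Sym: "w \<in> Sym (card X)"
    using standardize_in_Sym[OF distinct_word[OF assms(2)]] by (simp add: w_def)
  have p: "perm_of_word w (rank X x) = rank X (f x)" if x: "x \<in> X" for x
  proof -
    obtain i where i: "i < card X" "x = sorted_list_of_set X ! i"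
      using x assms(1) by (metis in_set_conv_nth set_sorted_list_of_set length_sorted_list_of_set)
    then have "rank X x = Suc i" using assms(1) rank_nth_sorted_list_of_set by simp
    then show ?thesis
      using i len X assms(1) by (simp add: perm_of_word_def w_def standardize_word)
  qed
  have "w \<in> Inv (card X) \<longleftrightarrow> (\<forall>i\<in>rank X ` X. perm_of_word w (perm_of_word w i) = i)"
    using bij_betw_rank[OF assms(1)] Sym by (simp add: Inv_def is_involution_iff bij_betw_def)
  also have "\<dots> \<longleftrightarrow> (\<forall>x\<in>X. rank X (f (f x)) = rank X x)"
  proof -
    have "rank X (f (f x)) = perm_of_word w (perm_of_word w (rank X x))" if "x \<in> X" for x
      using that p X(2) by (metis imageI)
    then show ?thesis by simp
  qed
  also have "\<dots> \<longleftrightarrow> (\<forall>x\<in>X. f (f x) = x)"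
  proof -
    have "rank X (f (f x)) = rank X x \<longleftrightarrow> f (f x) = x" if "x \<in> X" for x
      using that X(2) by (intro inj_on_eq_iff[OF inj_on_rank[OF assms(1)]]) auto
    then show ?thesis by simp
  qed
  finally show ?thesis using X(2) by (auto simp: w_def involution_on_def)
qed

lemma word_Inv_iff:
  assumes "bij_betw f {1..N} {1..N}"
  shows "word f {1..N} \<in> Inv N \<longleftrightarrow> involution_on {1..N} f"
proof -
  have "set (word f {1..N}) = {1..N}" using assms by (simp add: bij_betw_def)
  then have "word f {1..N} \<in> Sym N" using distinct_word[OF assms] by (simp add: Sym_iff)
  then show ?thesis using standardize_word_Inv_iff[OF _ assms] by (simp add: standardize_Sym)
qed

lemma Inv_obtain:
  assumes "w \<in> Inv N"
  obtains f where "word f {1..N} = w" "involution_on {1..N} f"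
proof -
  have w: "w \<in> Sym N" using assms by (simp add: Inv_def)
  then obtain f where f: "word f {1..N} = w" "bij_betw f {1..N} {1..N}"
    using word_of_list[of "{1..N}" w] length_Sym[OF w] by (auto simp: Sym_iff)
  then show ?thesis using that word_Inv_iff[OF f(2)] assms by simp
qed

section \<open>Involutions over a fixed permutation\<close>

text \<open>
  In matrix terms: the number of ones in the top left $m \times m$ corner.
\<close>

definition corner_size :: "nat \<Rightarrow> nat list \<Rightarrow> nat" where
  "corner_size m w = length (filter (\<lambda>x. x \<le> m) (take m w))"

text \<open>
  The possible values of \<open>\<pi>\<^sup>>\<^sup>m\<close> when \<open>u = \<sigma>\<^sup>>\<^sup>j\<close>: the copy of \<open>\<tau>\<close> is shifted
  above the letters of \<open>u\<close>, which are \<open>1, \<dots>, length u\<close>.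
\<close>

definition involution_shuffles :: "nat list \<Rightarrow> nat \<Rightarrow> nat list set" where
  "involution_shuffles u k = (\<Union>\<tau>\<in>Inv k. shuffles u (map ((+) (length u)) \<tau>))"

text \<open>
  The letters \<open>\<le> m\<close> of a permutation are exactly $1,\dots,m$, so they need no standardization.
\<close>

lemma values_le_Sym:
  assumes "w \<in> Sym N" "m \<le> N" shows "values_le m w = filter (\<lambda>x. x \<le> m) w"
proof -
  have "filter (\<lambda>x. x \<le> m) w \<in> Sym m" using assms by (auto simp: Sym_iff)
  then show ?thesis by (simp add: values_le_def standardize_Sym)
qed

lemma length_filter_eq_rank: "distinct d \<Longrightarrow> length (filter (\<lambda>x. x \<le> m) d) = rank (set d) m"
  by (simp add: rank_def distinct_length_filter Int_def conj_commute)

lemma Inv_over_iff: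
  "w \<in> Inv_over (n + m) m \<sigma> \<longleftrightarrow> w \<in> Inv (n + m) \<and>
    filter (\<lambda>x. x \<le> m) (take m w) @ filter (\<lambda>x. x \<le> m) (drop m w) = \<sigma>"
proof -
  have "filter (\<lambda>x. x \<le> m) (take m w) @ filter (\<lambda>x. x \<le> m) (drop m w) = filter (\<lambda>x. x \<le> m) w"
    by (simp flip: filter_append)
  then show ?thesis by (auto simp: Inv_over_def Inv_def values_le_Sym)
qed

lemma Inv_over_filter:
  assumes "w \<in> Inv_over (n + m) m \<sigma>"
  shows "filter (\<lambda>x. x \<le> m) (take m w) = take (corner_size m w) \<sigma>"
    and "filter (\<lambda>x. x \<le> m) (drop m w) = drop (corner_size m w) \<sigma>"
    and "corner_size m w \<le> length \<sigma>"
  using assms by (auto simp: Inv_over_iff corner_size_def)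

lemma is_involution_standardize_iff:
  "distinct v \<Longrightarrow> is_involution (standardize v) \<longleftrightarrow> standardize v \<in> Inv (length v)"
  using standardize_in_Sym by (simp add: Inv_def)

lemma finite_Inv [simp]: "finite (Inv N)"
  by (simp add: Inv_def Sym_def)

lemma filter_involution_shuffles:
  assumes "u \<in> Sym r" "w \<in> involution_shuffles u k"
  shows "w \<in> Sym (r + k)" "filter (\<lambda>x. x \<le> r) w = u"
    "\<exists>\<tau>\<in>Inv k. filter (\<lambda>x. \<not> x \<le> r) w = map ((+) r) \<tau>"
proof -
  obtain \<tau> where \<tau>: "\<tau> \<in> Inv k" "w \<in> shuffles u (map ((+) r) \<tau>)"
    using assms by (auto simp: involution_shuffles_def length_Sym)
  have "\<tau> \<in> Sym k" using \<tau> by (simp add: Inv_def)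
  then have pos: "\<forall>x\<in>set u. x \<le> r" "\<forall>y\<in>set (map ((+) r) \<tau>). \<not> y \<le> r"
    and set\<tau>: "set \<tau> = {1..k}" and len: "length \<tau> = k"
    using assms(1) length_Sym[of \<tau> k] by (auto simp: Sym_iff)
  have "set w = {1..r + k}"
  proof -
    have "set w = {1..r} \<union> (+) r ` {1..k}"
      using \<tau>(2) assms(1) set\<tau> by (simp add: set_shuffles Sym_iff)
    also have "\<dots> = {1..r + k}" by auto
    finally show ?thesis .
  qed
  moreover have "length w = r + k"
    using \<tau>(2) len assms(1) by (simp add: length_shuffles length_Sym)
  ultimately show "w \<in> Sym (r + k)" by (simp add: Sym_iff card_distinct)
  show "filter (\<lambda>x. x \<le> r) w = u" "\<exists>\<tau>\<in>Inv k. filter (\<lambda>x. \<not> x \<le> r) w = map ((+) r) \<tau>"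
    using \<tau> shuffles_eq_filter[OF pos] by auto
qed

text \<open>
  Symmetry of the matrix makes \<open>f\<close> an involution on the set \<open>A\<close> of positions \<open>\<le> m\<close> with
  letters \<open>\<le> m\<close>, and on the set \<open>Q\<close> of positions \<open>> m\<close> with letters \<open>> m\<close>. The first fact puts \<open>j\<close>
  into \<open>J(\<sigma>)\<close>, the second one identifies the large letters of the suffix.
\<close>

lemma suffix_gt_in_involution_shuffles:
  assumes \<sigma>: "\<sigma> \<in> Sym m" and w: "w \<in> Inv_over (n + m) m \<sigma>" and j: "corner_size m w = j"
  shows "j \<in> J_set \<sigma>" "m \<le> n + j"
    "suffix_gt m w \<in> involution_shuffles (suffix_gt j \<sigma>) (n + j - m)"
proof -
  obtain f where f: "word f {1..n + m} = w" "involution_on {1..n + m} f"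
    using w Inv_obtain[of w] by (auto simp: Inv_over_iff)
  define A where "A = {x \<in> {1..m}. f x \<le> m}"
  define Q where "Q = {x \<in> {m<..n + m}. \<not> f x \<le> m}"
  note filt = Inv_over_filter[OF w, unfolded j]
  have take: "take m w = word f {1..m}" and drop: "drop m w = word f {m<..n + m}"
    using take_word drop_word f(1) by blast+
  have f': "f x \<in> {1..n + m} \<and> f (f x) = x" if "x \<in> {1..n + m}" for x
    using f(2) that by (auto simp: involution_on_def)
  have distw: "distinct w" using w by (simp add: Inv_over_iff Inv_def Sym_iff)
  have lens: "length \<sigma> = m" "length w = n + m" "distinct \<sigma>"
    using \<sigma> f(1) by (auto simp: length_Sym Sym_iff)
  have invA: "involution_on A f" and invQ: "involution_on Q f"
    using f' unfolding involution_on_def A_def Q_def by force+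
  have wA: "word f A = take j \<sigma>"
    using filt(1) take filter_word[of "{1..m}" "\<lambda>x. x \<le> m" f] by (simp add: A_def)
  have wQ: "word f Q = filter (\<lambda>x. \<not> x \<le> m) (drop m w)"
    using drop filter_word[of "{m<..n + m}" "\<lambda>x. \<not> x \<le> m" f] by (simp add: Q_def)
  have "card A = j" using arg_cong[OF wA, of length] filt(3) lens by simp
  then have "standardize (take j \<sigma>) \<in> Inv j"
    using standardize_word_Inv_iff[of A f] invA involution_on_bij_betw[OF invA] wA by (simp add: A_def)
  then show "j \<in> J_set \<sigma>"
    using filt(3) by (simp add: J_set_def prefix_le_def Inv_def)
  have len: "length (filter (\<lambda>x. \<not> x \<le> m) (drop m w)) + (m - j) = n"
    using sum_length_filter_compl[of "\<lambda>x. x \<le> m" "drop m w"] filt lens by simp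
  then show "m \<le> n + j" by linarith
  have "card Q = n + j - m" using arg_cong[OF wQ, of length] len filt(3) lens by simp
  then have "standardize (filter (\<lambda>x. \<not> x \<le> m) (drop m w)) \<in> Inv (n + j - m)"
    using standardize_word_Inv_iff[of Q f] invQ involution_on_bij_betw[OF invQ] wQ by (simp add: Q_def)
  moreover have "rank (set (drop m w)) m = m - j"
    using length_filter_eq_rank[of "drop m w" m] distw filt(2) lens by simp
  then have "filter (\<lambda>x. x \<le> m - j) (suffix_gt m w) = suffix_gt j \<sigma>"
    "filter (\<lambda>x. \<not> x \<le> m - j) (suffix_gt m w) =
       map ((+) (m - j)) (standardize (filter (\<lambda>x. \<not> x \<le> m) (drop m w)))"
    using filter_le_standardize[of "drop m w" m] filter_gt_standardize[of "drop m w" m] filt(2)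
    by (simp_all add: suffix_gt_def)
  then have "suffix_gt m w \<in> shuffles (suffix_gt j \<sigma>)
       (map ((+) (m - j)) (standardize (filter (\<lambda>x. \<not> x \<le> m) (drop m w))))"
    using partition_in_shuffles[of "suffix_gt m w" "\<lambda>x. x \<le> m - j"] by simp
  moreover have "length (suffix_gt j \<sigma>) = m - j"
    using lens by (simp add: suffix_gt_def standardize_def)
  ultimately show "suffix_gt m w \<in> involution_shuffles (suffix_gt j \<sigma>) (n + j - m)"
    by (auto simp: involution_shuffles_def)
qed

text \<open>
  The standardized suffix tells which positions \<open>> m\<close> carry large letters, hence by symmetry
  which letters \<open>> m\<close> occur in the suffix; the small ones come from \<open>\<sigma>\<close>. So the set of letters is known
  and the standardization can be undone. In the corner, \<open>\<sigma>\<close> prescribes the letters and, as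
  letters and positions form the same set there, also their positions. Any other position is sent to a position
  \<open>> m\<close>, where the permutation is known already.
\<close>

lemma inj_on_suffix_gt:
  "inj_on (suffix_gt m) {w \<in> Inv_over (n + m) m \<sigma>. corner_size m w = j}"
proof (rule inj_onI, clarify)
  fix w w'
  assume w: "w \<in> Inv_over (n + m) m \<sigma>" and w': "w' \<in> Inv_over (n + m) m \<sigma>"
    and eq: "suffix_gt m w = suffix_gt m w'" and j: "corner_size m w' = corner_size m w"
      "j = corner_size m w"
  obtain f where f: "word f {1..n + m} = w" "involution_on {1..n + m} f"
    using w Inv_obtain[of w] by (auto simp: Inv_over_iff)
  obtain g where g: "word g {1..n + m} = w'" "involution_on {1..n + m} g"
    using w' Inv_obtain[of w'] by (auto simp: Inv_over_iff)
  define X where "X = {m<..n + m}"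
  have drop: "drop m w = word f X" "drop m w' = word g X"
    unfolding X_def using drop_word f(1) g(1) by blast+
  have dist: "distinct w" "distinct w'" using w w' by (auto simp: Inv_over_iff Inv_def Sym_iff)
  have f': "f x \<in> {1..n + m}" "f (f x) = x" and g': "g x \<in> {1..n + m}" "g (g x) = x"
    if "x \<in> {1..n + m}" for x
    using f(2) g(2) that by (auto simp: involution_on_def)
  note filt = Inv_over_filter[OF w] and filt' = Inv_over_filter[OF w', unfolded j]
  have rk: "rank (f ` X) (f x) = rank (g ` X) (g x)" if "x \<in> X" for x
    using eq that by (simp add: suffix_gt_def drop standardize_word X_def)
  have rkm: "rank (f ` X) m = rank (g ` X) m"
  proof -
    have "rank (set (drop m w)) m = rank (set (drop m w')) m"
      using length_filter_eq_rank[of "drop m w" m] length_filter_eq_rank[of "drop m w'" m]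
        dist filt(2) filt'(2) by simp
    then show ?thesis by (simp add: drop X_def)
  qed
  have le: "f x \<le> m \<longleftrightarrow> g x \<le> m" if "x \<in> X" for x
    using rk[OF that] rkm rank_le_iff[of "f ` X" "f x" m] rank_le_iff[of "g ` X" "g x" m] that
    by (simp add: X_def)
  have B: "{y \<in> f ` X. y \<le> m} = {y \<in> g ` X. y \<le> m}"
    using arg_cong[OF filt(2), of set] arg_cong[OF filt'(2), of set] by (simp add: drop X_def)
  have Q: "{y \<in> h ` X. \<not> y \<le> m} = {x \<in> X. \<not> h x \<le> m}"
    and A: "h ` {x \<in> {1..m}. h x \<le> m} = {x \<in> {1..m}. h x \<le> m}"
    if h: "involution_on {1..n + m} h" for h
  proof -
    have h': "h x \<in> {1..n + m}" "h (h x) = x" if "x \<in> {1..n + m}" for x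
      using h that by (auto simp: involution_on_def)
    have sub: "x \<in> {1..n + m}" if "x \<in> X \<or> x \<in> {1..m}" for x using that by (auto simp: X_def)
    show "{y \<in> h ` X. \<not> y \<le> m} = {x \<in> X. \<not> h x \<le> m}"
    proof (intro equalityI subsetI)
      fix y assume "y \<in> {y \<in> h ` X. \<not> y \<le> m}"
      then obtain x where x: "x \<in> X" "y = h x" "\<not> h x \<le> m" by auto
      then show "y \<in> {x \<in> X. \<not> h x \<le> m}" using h'[OF sub, of x] by (simp add: X_def)
    next
      fix x assume "x \<in> {x \<in> X. \<not> h x \<le> m}"
      then have "h x \<in> X" "x = h (h x)" "\<not> x \<le> m" using h'[OF sub, of x] by (simp_all add: X_def)
      then show "x \<in> {y \<in> h ` X. \<not> y \<le> m}" by (intro CollectI conjI image_eqI)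
    qed
    have "involution_on {x \<in> {1..m}. h x \<le> m} h"
      unfolding involution_on_def
    proof
      fix x assume "x \<in> {x \<in> {1..m}. h x \<le> m}"
      then show "h x \<in> {x \<in> {1..m}. h x \<le> m} \<and> h (h x) = x"
        using h'[of x] by simp
    qed
    from involution_on_bij_betw[OF this]
    show "h ` {x \<in> {1..m}. h x \<le> m} = {x \<in> {1..m}. h x \<le> m}"
      unfolding bij_betw_def by blast
  qed
  have "{y \<in> f ` X. \<not> y \<le> m} = {y \<in> g ` X. \<not> y \<le> m}"
    unfolding Q[OF f(2)] Q[OF g(2)] using le by blast
  with B have "f ` X = g ` X" by blast
  have "drop m w = drop m w'"
  proof (rule standardize_inject)
    show "set (drop m w) = set (drop m w')" using \<open>f ` X = g ` X\<close> by (simp add: drop X_def)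
    show "standardize (drop m w) = standardize (drop m w')" using eq by (simp only: suffix_gt_def)
  qed
  then have onX: "f x = g x" if "x \<in> X" for x
    using that by (simp add: drop X_def)
  have wA: "word f {x \<in> {1..m}. f x \<le> m} = word g {x \<in> {1..m}. g x \<le> m}"
  proof -
    have "word h {x \<in> {1..m}. h x \<le> m} = filter (\<lambda>x. x \<le> m) (take m (word h {1..n + m}))" for h
      unfolding take_word by (rule filter_word[symmetric]) simp
    from this[of f] this[of g] show ?thesis unfolding f(1) g(1) filt(1) filt'(1) by (rule trans[OF _ sym])
  qed
  have Aeq: "{x \<in> {1..m}. f x \<le> m} = {x \<in> {1..m}. g x \<le> m}"
  proof -
    have "f ` {x \<in> {1..m}. f x \<le> m} = g ` {x \<in> {1..m}. g x \<le> m}"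
      using arg_cong[OF wA, of set] by simp
    then show ?thesis unfolding A[OF f(2)] A[OF g(2)] .
  qed
  have onA: "f x = g x" if "x \<in> {1..m}" "f x \<le> m" for x
    using wA that unfolding Aeq[symmetric] by simp
  have "f x = g x" if x: "x \<in> {1..n + m}" for x
  proof -
    have "x \<in> X \<or> x \<in> {1..m} \<and> f x \<le> m \<or> f x \<in> X"
      using x f'(1)[OF x] unfolding X_def atLeastAtMost_iff greaterThanAtMost_iff by linarith
    then consider "x \<in> X" | "x \<in> {1..m}" "f x \<le> m" | "f x \<in> X" by blast
    then show ?thesis
    proof cases
      case 3
      then have "g (f x) = x" using onX[of "f x"] f'(2)[OF x] by simp
      then show ?thesis using g'(2)[OF f'(1)[OF x]] by simp
    qed (fact onX, fact onA)
  qed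
  then have "word f {1..n + m} = word g {1..n + m}" by simp
  then show "w = w'" unfolding f(1) g(1) .
qed

text \<open>
  The involution is assembled from four pieces: \<open>a\<close> on \<open>A\<close>, read off from the first \<open>j\<close> letters of
  \<open>\<sigma>\<close>; a map \<open>h\<close> on the positions \<open>> m\<close>, obtained by replacing the letters of \<open>v\<close> by the elements of \<open>D\<close> in the
  same order, and consisting of an involution on \<open>Q\<close> and a bijection from \<open>X - Q\<close> onto \<open>B\<close>;
  and the inverse of this bijection on \<open>B\<close>. The set \<open>D\<close> of letters of the suffix has to be \<open>B \<union> Q\<close>,
  because an involution maps the positions of large letters in the suffix onto themselves.
\<close>

lemma suffix_gt_surj:
  assumes \<sigma>: "\<sigma> \<in> Sym m" and j: "j \<in> J_set \<sigma>" "m \<le> n + j"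
    and v: "v \<in> involution_shuffles (suffix_gt j \<sigma>) (n + j - m)"
  shows "\<exists>w\<in>Inv_over (n + m) m \<sigma>. corner_size m w = j \<and> suffix_gt m w = v"
proof -
  define r where "r = m - j"
  define X where "X = {m<..n + m}"
  define A where "A = set (take j \<sigma>)"
  define B where "B = set (drop j \<sigma>)"
  have lens: "length \<sigma> = m" "distinct \<sigma>" and set\<sigma>: "set \<sigma> = {1..m}"
    using \<sigma> by (auto simp: length_Sym Sym_iff)
  have jm: "j \<le> m" using j lens by (simp add: J_set_def)
  have AB: "A \<union> B = {1..m}" "A \<inter> B = {}"
    using set\<sigma> lens(2) unfolding A_def B_def
    by (metis append_take_drop_id set_append, metis append_take_drop_id distinct_append)
  have cardB: "card B = r" using lens distinct_card[of "drop j \<sigma>"] by (simp add: B_def r_def)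
  have "suffix_gt j \<sigma> \<in> Sym r"
    using standardize_in_Sym[of "drop j \<sigma>"] lens by (simp add: suffix_gt_def r_def)
  from filter_involution_shuffles[OF this v] obtain \<tau> where
    v': "v \<in> Sym n" "filter (\<lambda>x. x \<le> r) v = suffix_gt j \<sigma>" "\<tau> \<in> Inv (n + j - m)"
    "filter (\<lambda>x. \<not> x \<le> r) v = map ((+) r) \<tau>"
    using j(2) jm by (auto simp: r_def)
  have finX: "finite X" "card X = n" by (simp_all add: X_def)
  obtain g where g: "word g X = v" "bij_betw g X {1..n}"
    using word_of_list[of X v] v'(1) finX by (auto simp: Sym_iff length_Sym[OF v'(1)])
  define Q where "Q = {x \<in> X. \<not> g x \<le> r}"
  define D where "D = B \<union> Q"
  have "word g Q = map ((+) r) \<tau>"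
    using v'(4) filter_word[OF finX(1), of "\<lambda>x. \<not> x \<le> r" g] by (simp add: g Q_def)
  then have "length (word g Q) = length \<tau>" by (metis length_map)
  then have cardQ: "card Q = n + j - m"
    using v'(3) by (simp add: Inv_def length_Sym)
  have BQ: "B \<subseteq> {1..m}" "Q \<subseteq> X" "B \<inter> Q = {}" "finite B" "finite Q"
    using AB finX(1) by (auto simp: Q_def X_def B_def)
  have D: "finite D" "card D = n"
    using BQ cardB cardQ j(2) jm by (auto simp: D_def card_Un_disjoint r_def)
  define h where "h = (\<lambda>x. inv_into D (rank D) (g x))"
  have rank_D: "bij_betw (rank D) D {1..n}" using bij_betw_rank[OF D(1)] D(2) by simp
  have h: "bij_betw h X D"
    unfolding h_def using bij_betw_trans[OF g(2) bij_betw_inv_into[OF rank_D]] by (simp add: o_def)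
  have rank_h: "rank D (h x) = g x" if "x \<in> X" for x
    unfolding h_def using that g(2) rank_D by (intro f_inv_into_f) (auto simp: bij_betw_def)
  have hX: "h ` X = D" using h by (simp add: bij_betw_def)
  have std_h: "standardize (word h X) = v"
    using rank_h finX(1) by (simp add: standardize_word hX flip: g(1))
  have DB: "{y \<in> D. y \<le> m} = B" and DQ: "{y \<in> D. \<not> y \<le> m} = Q"
    using BQ by (auto simp: D_def X_def)
  have rank_m: "rank D m = r" using DB cardB by (simp add: rank_def)
  have h_le: "h x \<le> m \<longleftrightarrow> g x \<le> r" if "x \<in> X" for x
    using rank_le_iff[OF D(1), of "h x" m] that hX rank_h rank_m by force
  have setw: "set (word h X) = D" using finX(1) hX by simp
  have small: "filter (\<lambda>x. x \<le> m) (word h X) = drop j \<sigma>"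
  proof (rule standardize_inject)
    show "set (filter (\<lambda>x. x \<le> m) (word h X)) = set (drop j \<sigma>)"
      using DB setw by (simp add: B_def)
    show "standardize (filter (\<lambda>x. x \<le> m) (word h X)) = standardize (drop j \<sigma>)"
      using filter_le_standardize[of "word h X" m] v'(2) unfolding setw rank_m std_h
      by (simp add: suffix_gt_def)
  qed
  have Q_alt: "{x \<in> X. \<not> h x \<le> m} = Q" using h_le by (auto simp: Q_def)
  have word_Q: "filter (\<lambda>x. \<not> x \<le> m) (word h X) = word h Q"
    using filter_word[OF finX(1), of "\<lambda>x. \<not> x \<le> m" h] by (simp add: Q_alt)
  have hQ: "bij_betw h Q Q"
  proof -
    have "h ` Q = Q" using arg_cong[OF word_Q, of set] DQ setw BQ(5) by simp
    then show ?thesis using h BQ(2) by (auto simp: bij_betw_def intro: inj_on_subset)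
  qed
  have "standardize (word h Q) = \<tau>"
    using filter_gt_standardize[of "word h X" m] v'(4) unfolding setw rank_m std_h word_Q
    by simp
  then have invQ: "involution_on Q h"
    using standardize_word_Inv_iff[OF BQ(5) hQ] v'(3) cardQ by simp
  have hP: "bij_betw h (X - Q) B"
  proof -
    have "X - Q = {x \<in> X. h x \<le> m}" using h_le by (auto simp: Q_def)
    then have "h ` (X - Q) = {y \<in> h ` X. y \<le> m}" by blast
    then have "h ` (X - Q) = B" unfolding hX DB .
    then show ?thesis using h by (auto simp: bij_betw_def intro: inj_on_subset)
  qed
  have cardA: "card A = j" using lens jm distinct_card[of "take j \<sigma>"] by (simp add: A_def)
  obtain a where a: "word a A = take j \<sigma>" "bij_betw a A A"
    using word_of_list[of A "take j \<sigma>"] lens jm cardA unfolding A_def by auto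
  have "standardize (take j \<sigma>) \<in> Inv j"
    using j(1) is_involution_standardize_iff[of "take j \<sigma>"] lens jm by (simp add: J_set_def prefix_le_def)
  then have invA: "involution_on A a"
    using standardize_word_Inv_iff[of A a] a cardA by (simp add: A_def)
  define f where "f = (\<lambda>x. if x \<in> A then a x else if x \<in> B then inv_into (X - Q) h x else h x)"
  have notX: "x \<notin> X" if "x \<in> A \<union> B" for x using that AB by (auto simp: X_def)
  have fA: "f x = a x" if "x \<in> A" for x using that by (simp add: f_def)
  have fB: "f x = inv_into (X - Q) h x" if "x \<in> B" for x using that AB by (auto simp: f_def)
  have fX: "f x = h x" if "x \<in> X" for x using that notX by (auto simp: f_def)
  have N: "{1..n + m} = A \<union> B \<union> X" unfolding AB by (auto simp: X_def)
  have inv_f: "involution_on {1..n + m} f"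
    unfolding involution_on_def N
  proof
    fix x assume "x \<in> A \<union> B \<union> X"
    then consider "x \<in> A" | "x \<in> B" | "x \<in> Q" | "x \<in> X - Q" by blast
    then show "f x \<in> A \<union> B \<union> X \<and> f (f x) = x"
    proof cases
      case 1
      then show ?thesis using invA by (simp add: fA involution_on_def)
    next
      case 2
      then have "inv_into (X - Q) h x \<in> X - Q" "h (inv_into (X - Q) h x) = x"
        using hP inv_into_into[of x h "X - Q"] f_inv_into_f[of x h "X - Q"]
        unfolding bij_betw_def by blast+
      then show ?thesis using 2 by (simp add: fB fX)
    next
      case 3
      then have "x \<in> X" "h x \<in> X" "h (h x) = x" using invQ BQ(2) by (auto simp: involution_on_def)
      then show ?thesis by (simp add: fX)
    next
      case 4
      then have "h x \<in> B" "inv_into (X - Q) h (h x) = x"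
        using hP by (auto simp: bij_betw_def)
      then show ?thesis using 4 by (simp add: fB fX)
    qed
  qed
  define w where "w = word f {1..n + m}"
  have wInv: "w \<in> Inv (n + m)"
    using word_Inv_iff[OF involution_on_bij_betw[OF inv_f]] inv_f by (simp add: w_def)
  have drop: "drop m w = word h X"
    using fX finX(1) by (simp add: w_def drop_word X_def[symmetric] del: One_nat_def)
  have "{x \<in> {1..m}. f x \<le> m} = A"
  proof -
    have "f x \<in> A" if "x \<in> A" for x using that invA by (simp add: fA involution_on_def)
    moreover have "f x \<in> X" if "x \<in> B" for x
      using that hP fB[OF that] inv_into_into[of x h "X - Q"] by (simp add: bij_betw_def)
    moreover have "y \<le> m" if "y \<in> A" for y using that AB(1) by auto
    moreover have "\<not> y \<le> m" if "y \<in> X" for y using that by (simp add: X_def)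
    ultimately show ?thesis unfolding AB(1)[symmetric] by blast
  qed
  then have "filter (\<lambda>x. x \<le> m) (take m w) = word f A"
    unfolding w_def take_word by (subst filter_word) simp_all
  also have "word f A = word a A" using fA by (simp add: A_def)
  finally have take: "filter (\<lambda>x. x \<le> m) (take m w) = take j \<sigma>" unfolding a(1) .
  have "w \<in> Inv_over (n + m) m \<sigma>" using wInv take small by (simp add: Inv_over_iff drop)
  moreover have "corner_size m w = j" using take jm lens by (simp add: corner_size_def)
  moreover have "suffix_gt m w = v" by (simp add: suffix_gt_def drop std_h)
  ultimately show ?thesis by blast
qed

lemma bij_betw_suffix_gt:
  assumes "\<sigma> \<in> Sym m" "j \<in> J_set \<sigma>" "m \<le> n + j"
  shows "bij_betw (suffix_gt m) {w \<in> Inv_over (n + m) m \<sigma>. corner_size m w = j}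
    (involution_shuffles (suffix_gt j \<sigma>) (n + j - m))"
proof (rule bij_betw_imageI[OF inj_on_suffix_gt], intro equalityI subsetI)
  fix v assume "v \<in> involution_shuffles (suffix_gt j \<sigma>) (n + j - m)"
  then show "v \<in> suffix_gt m ` {w \<in> Inv_over (n + m) m \<sigma>. corner_size m w = j}"
    using suffix_gt_surj[OF assms] by blast
qed (use suffix_gt_in_involution_shuffles(3)[OF assms(1)] in blast)

lemma sum_involution_shuffles:
  assumes "u \<in> Sym r"
  shows "(\<Sum>w\<in>involution_shuffles u k. monom (1 :: int) (maj w)) =
    monom 1 (maj u) * q_binomial (r + k) k * inv_maj_poly k"
proof -
  have \<tau>_len: "length \<tau> = k" if "\<tau> \<in> Inv k" for \<tau>
    using that by (simp add: length_Sym Inv_def)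
  have lt: "\<forall>a\<in>set u. \<forall>b\<in>set (map ((+) r) \<tau>). a < b" if "\<tau> \<in> Inv k" for \<tau>
    using assms that by (auto simp: Sym_iff Inv_def)
  have disj: "shuffles u (map ((+) r) \<tau>) \<inter> shuffles u (map ((+) r) \<tau>') = {}"
    if "\<tau> \<in> Inv k" "\<tau>' \<in> Inv k" "\<tau> \<noteq> \<tau>'" for \<tau> \<tau>'
  proof -
    have "\<forall>x\<in>set u. x \<le> r" using assms by (simp add: Sym_iff)
    moreover have "\<forall>y\<in>set (map ((+) r) \<rho>). \<not> y \<le> r" if "\<rho> \<in> Inv k" for \<rho>
      using that by (auto simp: Inv_def Sym_iff)
    moreover have "map ((+) r) \<tau> \<noteq> map ((+) r) \<tau>'" using that(3) by simp
    ultimately show ?thesis using that shuffles_eq_filter[of u "\<lambda>x. x \<le> r"] by auto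
  qed
  have "(\<Sum>w\<in>involution_shuffles u k. monom (1 :: int) (maj w)) =
      (\<Sum>\<tau>\<in>Inv k. \<Sum>w\<in>shuffles u (map ((+) r) \<tau>). monom 1 (maj w))"
    unfolding involution_shuffles_def length_Sym[OF assms]
    by (rule sum.UNION_disjoint) (use disj in auto)
  also have "\<dots> = (\<Sum>\<tau>\<in>Inv k. monom 1 (maj u) * q_binomial (r + k) k * monom 1 (maj \<tau>))"
  proof (rule sum.cong[OF refl])
    fix \<tau> assume \<tau>: "\<tau> \<in> Inv k"
    have "maj (map ((+) r) \<tau>) = maj \<tau>" by (intro maj_map_strict_mono strict_monoI) simp
    then have "(\<Sum>w\<in>shuffles u (map ((+) r) \<tau>). monom (1 :: int) (maj w)) =
        monom 1 (maj u + maj \<tau>) * q_binomial (r + k) r"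
      using sum_maj_shuffles[OF lt[OF \<tau>]] \<tau>_len[OF \<tau>] by (simp add: length_Sym[OF assms])
    also have "monom (1 :: int) (maj u + maj \<tau>) = monom 1 (maj u) * monom 1 (maj \<tau>)"
      by (simp add: mult_monom)
    finally show "(\<Sum>w\<in>shuffles u (map ((+) r) \<tau>). monom (1 :: int) (maj w)) =
        monom 1 (maj u) * q_binomial (r + k) k * monom 1 (maj \<tau>)"
      using q_binomial_sym[of r k] by (simp add: mult_ac)
  qed
  finally show ?thesis by (simp add: inv_maj_poly_def sum_distrib_left)
qed

theorem theorem1p1:
  fixes m n :: nat and \<sigma> :: "nat list"
  assumes "\<sigma> \<in> Sym m"
  shows "(\<Sum>\<pi>\<in>Inv_over (n + m) m \<sigma>. monom (1 :: int) (maj (suffix_gt m \<pi>))) =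
    (\<Sum>j | j \<in> J_set \<sigma> \<and> m \<le> n + j.
       let k = n + j - m
       in monom 1 (maj (suffix_gt j \<sigma>)) * q_binomial n k * inv_maj_poly k)"
proof -
  let ?J = "{j. j \<in> J_set \<sigma> \<and> m \<le> n + j}"
  let ?F = "\<lambda>j. {\<pi> \<in> Inv_over (n + m) m \<sigma>. corner_size m \<pi> = j}"
  have "finite (Inv_over (n + m) m \<sigma>)" by (simp add: Inv_over_def)
  moreover have "finite ?J" by (simp add: J_set_def)
  moreover have "corner_size m ` Inv_over (n + m) m \<sigma> \<subseteq> ?J"
    using suffix_gt_in_involution_shuffles(1,2)[OF assms] by blast
  ultimately have "(\<Sum>\<pi>\<in>Inv_over (n + m) m \<sigma>. monom (1 :: int) (maj (suffix_gt m \<pi>))) =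
      (\<Sum>j\<in>?J. \<Sum>\<pi>\<in>?F j. monom 1 (maj (suffix_gt m \<pi>)))"
    by (simp add: sum.group)
  also have "\<dots> = (\<Sum>j\<in>?J. let k = n + j - m
       in monom 1 (maj (suffix_gt j \<sigma>)) * q_binomial n k * inv_maj_poly k)"
  proof (rule sum.cong[OF refl])
    fix j assume "j \<in> ?J"
    then have j: "j \<in> J_set \<sigma>" "m \<le> n + j" by auto
    have jm: "j \<le> m" using j(1) length_Sym[OF assms] by (simp add: J_set_def)
    have Sym: "suffix_gt j \<sigma> \<in> Sym (m - j)"
      using standardize_in_Sym[of "drop j \<sigma>"] assms length_Sym[OF assms]
      by (simp add: suffix_gt_def Sym_iff)
    have "m - j + (n + j - m) = n" using j(2) jm by simp
    then show "(\<Sum>\<pi>\<in>?F j. monom 1 (maj (suffix_gt m \<pi>))) = (let k = n + j - m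
       in monom 1 (maj (suffix_gt j \<sigma>)) * q_binomial n k * inv_maj_poly k)"
      using sum.reindex_bij_betw[OF bij_betw_suffix_gt[OF assms j], of "\<lambda>w. monom (1 :: int) (maj w)"]
        sum_involution_shuffles[OF Sym, of "n + j - m"] by (simp add: Let_def)
  qed
  finally show ?thesis .
qed

end
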